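(* Suppose the smoothness and strong convexity assumptions (A1) and (A2) hold and let $\lambda>0$. Let $\{\boldsymbol{w}_t^{(g)}\}$ and $\{\boldsymbol{w}_{t,K}^{(i)}\}$, $i\in[m]$, be the sequences generated by the algorithm described in the context with step sizes $0<\gamma<1/L_g$ and $0<\eta\le1/L_\ell$, and with the number $K$ of inner-loop iterations satisfying $$\big(2+64L_w^2(1/\mu_g)^2\lambda^2\big)(1-\eta\mu_\ell)^K\le(1-\gamma L_g)^4.$$ Then $\boldsymbol{w}_t^{(g)}$ converges to $\widetilde{\boldsymbol{w}}^{(g)}$ linearly at rate $1-\frac{\gamma\mu_g}{2}-\frac{(\gamma\mu_g)^2}{2}$, and for any $i\in[m]$, $\boldsymbol{w}_{t,0}^{(i)}$ converges to $\widetilde{\boldsymbol{w}}^{(i)}$ linearly at the same rate.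
   Context: Setting. For $i\in[m]=\{1,\dots,m\}$, client $i$ has a data set $S_i=\{z_{ij}\}_{j\in[n_i]}$; $\ell(\boldsymbol{w},z)$ is a loss function differentiable in $\boldsymbol{w}\in\mathbb{R}^d$, and $L_i(\boldsymbol{w},S_i)=\frac1{n_i}\sum_{j=1}^{n_i}\ell(\boldsymbol{w},z_{ij})$. For $\lambda>0$ let $h_i(\boldsymbol{w}^{(i)},\boldsymbol{w}^{(g)})=L_i(\boldsymbol{w}^{(i)},S_i)+\frac\lambda2\|\boldsymbol{w}^{(g)}-\boldsymbol{w}^{(i)}\|^2$, and let $(\widetilde{\boldsymbol{w}}^{(g)},\{\widetilde{\boldsymbol{w}}^{(i)}\}_{i=1}^m)$ be the minimizer of $\frac1m\sum_{i=1}^m h_i(\boldsymbol{w}^{(i)},\boldsymbol{w}^{(g)})$ over all $\boldsymbol{w}^{(g)},\boldsymbol{w}^{(1)},\dots,\boldsymbol{w}^{(m)}\in\mathbb{R}^d$. Assumptions. (A1) $\|\nabla\ell(x,z)-\nabla\ell(y,z)\|\le L\|x-y\|$ for all $x,y\in\mathbb{R}^d$ and all $z$. (A2) Each $L_i(\cdot,S_i)$ is $\mu$-strongly convex, $\mu>0$. Constants: $\mu_g=\frac{\lambda\mu}{\lambda+\mu}$, $L_g=\frac{\lambda L}{\lambda+L}$, $\mu_\ell=\mu+\lambda$, $L_\ell=L+\lambda$, $L_w=\frac{\lambda}{\lambda+\mu}$. Algorithm (deterministic federated gradient descent with $K$ local steps). Start from an arbitrary global model $\boldsymbol{w}_1^{(g)}$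 and arbitrary local models $\boldsymbol{w}_{0,K}^{(i)}$, $i\in[m]$. For rounds $t=1,2,\dots$: for each $i$ set $\boldsymbol{w}_{t,0}^{(i)}=\boldsymbol{w}_{t-1,K}^{(i)}$; for $k=0,\dots,K-1$ set $\boldsymbol{w}_{t,k+1}^{(i)}=\boldsymbol{w}_{t,k}^{(i)}-\eta\big(\nabla L_i(\boldsymbol{w}_{t,k}^{(i)},S_i)+\lambda(\boldsymbol{w}_{t,k}^{(i)}-\boldsymbol{w}_t^{(g)})\big)$; then set $\boldsymbol{w}_{t+1}^{(g)}=\boldsymbol{w}_t^{(g)}-\frac{\gamma}{m}\sum_{i=1}^m\lambda(\boldsymbol{w}_t^{(g)}-\boldsymbol{w}_{t,K}^{(i)})$. Convention: a sequence $x_t$ converges to $x$ linearly at rate $r\in(0,1)$ if there is a constant $C$ independent of $t$ (possibly depending on the initialization and problem parameters) with $\|x_t-x\|^2\le C r^t$ for all $t$. *)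

theory Defs
  imports "HOL-Analysis.Analysis"
begin

definition gradient :: "('a::real_inner \<Rightarrow> real) \<Rightarrow> 'a \<Rightarrow> 'a" where
  "gradient f x = (THE D. GDERIV f x :> D)"

definition strongly_convex :: "real \<Rightarrow> ('a::real_inner \<Rightarrow> real) \<Rightarrow> bool" where
  "strongly_convex \<mu> f \<longleftrightarrow>
     (\<forall>x y. \<forall>t\<in>{0..1}. f ((1 - t) *\<^sub>R x + t *\<^sub>R y)
        \<le> (1 - t) * f x + t * f y - \<mu> / 2 * t * (1 - t) * (norm (x - y))\<^sup>2)"

text \<open>Clients are numbered by \<open>{1..m}\<close>; client \<open>i\<close> holds the data \<open>z i 1, \<dots>, z i (n i)\<close>.\<close>

definition client_loss ::
  "('a \<Rightarrow> 'z \<Rightarrow> real) \<Rightarrow> (nat \<Rightarrow> nat) \<Rightarrow> (nat \<Rightarrow> nat \<Rightarrow> 'z) \<Rightarrow> nat \<Rightarrow> 'a \<Rightarrow> real" where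
  "client_loss l n z i w = 1 / real (n i) * (\<Sum>j=1..n i. l w (z i j))"

definition client_objective ::
  "real \<Rightarrow> ('a::real_normed_vector \<Rightarrow> real) \<Rightarrow> 'a \<Rightarrow> 'a \<Rightarrow> real" where
  "client_objective lam f w wg = f w + lam / 2 * (norm (wg - w))\<^sup>2"

text \<open>\<open>F i\<close> is the loss of client \<open>i\<close>. A family of local models is a function on \<open>nat\<close>, of which
  only the values on \<open>{1..m}\<close> matter.\<close>

definition fed_objective ::
  "real \<Rightarrow> nat \<Rightarrow> (nat \<Rightarrow> 'a::real_normed_vector \<Rightarrow> real) \<Rightarrow> 'a \<times> (nat \<Rightarrow> 'a) \<Rightarrow> real" where
  "fed_objective lam m F = (\<lambda>(wg, w). 1 / real m * (\<Sum>i=1..m. client_objective lam (F i) (w i) wg))"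

text \<open>\<open>wg t\<close> is the global model in round \<open>t\<close>, and \<open>w i t k\<close> the local model of client \<open>i\<close> after
  \<open>k\<close> local steps of round \<open>t\<close>. Rounds start at \<open>t = 1\<close>; the initial values \<open>wg 1\<close> and \<open>w i 0 K\<close>
  are unconstrained, and all entries not mentioned in the recursion are irrelevant.\<close>

definition fed_gd ::
  "real \<Rightarrow> real \<Rightarrow> real \<Rightarrow> nat \<Rightarrow> nat \<Rightarrow> (nat \<Rightarrow> 'a::real_inner \<Rightarrow> real) \<Rightarrow>
   (nat \<Rightarrow> 'a) \<Rightarrow> (nat \<Rightarrow> nat \<Rightarrow> nat \<Rightarrow> 'a) \<Rightarrow> bool" where
  "fed_gd lam \<eta> \<gamma> K m F wg w \<longleftrightarrow>
     (\<forall>t\<ge>1.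
        (\<forall>i\<in>{1..m}. w i t 0 = w i (t - 1) K \<and>
           (\<forall>k<K. w i t (k + 1) =
              w i t k - \<eta> *\<^sub>R (gradient (F i) (w i t k) + lam *\<^sub>R (w i t k - wg t)))) \<and>
        wg (t + 1) = wg t - (\<gamma> / real m) *\<^sub>R (\<Sum>i=1..m. lam *\<^sub>R (wg t - w i t K)))"

definition mu_g :: "real \<Rightarrow> real \<Rightarrow> real" where "mu_g lam \<mu> = lam * \<mu> / (lam + \<mu>)"
definition L_g :: "real \<Rightarrow> real \<Rightarrow> real" where "L_g lam L = lam * L / (lam + L)"
definition mu_l :: "real \<Rightarrow> real \<Rightarrow> real" where "mu_l lam \<mu> = \<mu> + lam"
definition L_l :: "real \<Rightarrow> real \<Rightarrow> real" where "L_l lam L = L + lam"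
definition L_w :: "real \<Rightarrow> real \<Rightarrow> real" where "L_w lam \<mu> = lam / (lam + \<mu>)"

text \<open>The sequences to which this is applied are indexed from \<open>1\<close>.\<close>

definition converges_linearly :: "(nat \<Rightarrow> 'a::real_normed_vector) \<Rightarrow> 'a \<Rightarrow> real \<Rightarrow> bool" where
  "converges_linearly x l r \<longleftrightarrow>
     0 < r \<and> r < 1 \<and> (\<exists>C. \<forall>t\<ge>1. (norm (x t - l))\<^sup>2 \<le> C * r ^ t)"

end

theory Submission
  imports Defs
begin

text \<open>Minimizing out the local models turns the problem into the minimization of the average of the
  Moreau envelopes of the client losses, whose gradients \<open>v \<mapsto> lam (v - prox v)\<close> are strongly monotone
  with constant \<open>mu_g\<close> and cocoercive with constant \<open>1 / L_g\<close>. The global update is a gradient step for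
  this average, perturbed by the mean distance \<open>E t\<close> of the local models from the proximal points. The
  local steps contract that distance, while the motion of the global model increases it. With
  \<open>D t\<close> the global error, these effects form a linear recursion for \<open>(D t, E t)\<close>; the
  condition on \<open>K\<close> makes a suitable weighted sum \<open>D t + b * E t\<close> shrink by the square root of the
  claimed rate in every round.\<close>

section \<open>Gradients and a single gradient step\<close>

lemma gradient_eqI:
  assumes "GDERIV f x :> D"
  shows "gradient f x = D"
  unfolding gradient_def
proof (rule the_equality)
  show "GDERIV f x :> D"
    by (rule assms)
next
  fix D' assume "GDERIV f x :> D'"
  then have "(\<lambda>h. inner h D') = (\<lambda>h. inner h D)"
    using assms unfolding gderiv_def by (rule has_derivative_unique)
  then have "inner (D' - D) D' = inner (D' - D) D"
    by (rule fun_cong)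
  then show "D' = D"
    by (metis inner_diff_right inner_eq_zero_iff right_minus_eq)
qed

text \<open>The derivative is a linear functional, and in a Euclidean space it is represented by the
  vector with coordinates \<open>f' b\<close> along the basis.\<close>

lemma GDERIV_gradient:
  fixes f :: "'a::euclidean_space \<Rightarrow> real"
  assumes "f differentiable (at x)"
  shows "GDERIV f x :> gradient f x"
proof -
  obtain f' where f': "(f has_derivative f') (at x)"
    using assms unfolding differentiable_def by blast
  then have lin: "linear f'"
    by (rule has_derivative_linear)
  have "f' = (\<lambda>h. inner h (\<Sum>b\<in>Basis. f' b *\<^sub>R b))"
  proof
    fix h
    have "f' h = f' (\<Sum>b\<in>Basis. (h \<bullet> b) *\<^sub>R b)"
      by (simp add: euclidean_representation)
    also have "\<dots> = (\<Sum>b\<in>Basis. (h \<bullet> b) * f' b)"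
      by (simp add: linear_sum[OF lin] linear_scale[OF lin])
    finally show "f' h = inner h (\<Sum>b\<in>Basis. f' b *\<^sub>R b)"
      by (simp add: inner_sum_right mult.commute)
  qed
  then have "GDERIV f x :> (\<Sum>b\<in>Basis. f' b *\<^sub>R b)"
    using f' unfolding gderiv_def by simp
  then show ?thesis
    using gradient_eqI by metis
qed

lemma GDERIV_sum:
  assumes "\<And>i. i \<in> I \<Longrightarrow> GDERIV (f i) x :> D i"
  shows "GDERIV (\<lambda>x. \<Sum>i\<in>I. f i x) x :> (\<Sum>i\<in>I. D i)"
  using assms unfolding gderiv_def inner_sum_right by (intro has_derivative_sum) auto

lemma GDERIV_cmult:
  assumes "GDERIV f x :> D"
  shows "GDERIV (\<lambda>x. c * f x) x :> c *\<^sub>R D"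
  using assms unfolding gderiv_def inner_scaleR_right by (rule has_derivative_mult_right)

lemma GDERIV_norm_diff_square:
  "GDERIV (\<lambda>x. (norm (v - x))\<^sup>2) x :> 2 *\<^sub>R (x - v)"
  unfolding gderiv_def power2_norm_eq_inner
  by (auto intro!: derivative_eq_intros simp: algebra_simps inner_commute)

lemma GDERIV_minimum:
  assumes "GDERIV f x :> D" and "\<And>y. f x \<le> f y"
  shows "D = 0"
proof -
  have "(\<lambda>h. inner h D) = (\<lambda>h. 0)"
    using assms unfolding gderiv_def by (intro has_derivative_local_min) auto
  then have "inner D D = 0"
    by (rule fun_cong)
  then show ?thesis
    by simp
qed

lemma GDERIV_along_line:
  assumes "GDERIV f (x + t *\<^sub>R d) :> D"
  shows "((\<lambda>t. f (x + t *\<^sub>R d)) has_real_derivative inner d D) (at t)"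
proof -
  have "((\<lambda>t. x + t *\<^sub>R d) has_derivative (\<lambda>h. h *\<^sub>R d)) (at t)"
    by (auto intro!: derivative_eq_intros)
  from has_derivative_compose[OF this assms[unfolded gderiv_def]]
  show ?thesis
    by (simp add: has_field_derivative_def mult.commute[of _ "inner d D"] mult_commute_abs)
qed

text \<open>In the expanded square, half of the cross term absorbs the quadratic term by
  cocoercivity, and strong monotonicity turns the other half into decrease. \<open>G\<close> stands
  for the difference of an operator at two points and \<open>d\<close> for the difference of the
  points. This covers both the local steps and the averaged global step.\<close>

lemma gradient_step_contraction:
  fixes d G :: "'a::real_inner"
  assumes "c * (norm d)\<^sup>2 \<le> inner G d" and "(norm G)\<^sup>2 \<le> M * inner G d"
    and "0 \<le> \<gamma>" "\<gamma> * M \<le> 1" "0 \<le> c"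
  shows "(norm (d - \<gamma> *\<^sub>R G))\<^sup>2 \<le> (1 - \<gamma> * c) * (norm d)\<^sup>2"
proof -
  have "0 \<le> inner G d"
    using assms by (meson mult_nonneg_nonneg order_trans zero_le_power2)
  have "\<gamma>\<^sup>2 * (norm G)\<^sup>2 \<le> \<gamma>\<^sup>2 * (M * inner G d)"
    using assms by (intro mult_left_mono) auto
  also have "\<dots> = (\<gamma> * M) * (\<gamma> * inner G d)"
    by (simp add: power2_eq_square)
  also have "\<dots> \<le> 1 * (\<gamma> * inner G d)"
    using assms \<open>0 \<le> inner G d\<close> by (intro mult_right_mono) auto
  finally have *: "\<gamma>\<^sup>2 * (norm G)\<^sup>2 \<le> \<gamma> * inner G d" by simp
  have **: "\<gamma> * (c * (norm d)\<^sup>2) \<le> \<gamma> * inner G d"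
    using assms by (intro mult_left_mono) auto
  have "(norm (d - \<gamma> *\<^sub>R G))\<^sup>2 = (norm d)\<^sup>2 - 2 * (\<gamma> * inner G d) + \<gamma>\<^sup>2 * (norm G)\<^sup>2"
    unfolding power2_norm_eq_inner by (simp add: algebra_simps inner_commute power2_eq_square)
  then show ?thesis
    using * ** by (simp add: algebra_simps)
qed

section \<open>Inequalities for smooth strongly convex functions\<close>

locale smooth_strongly_convex =
  fixes f :: "'a::euclidean_space \<Rightarrow> real" and g :: "'a \<Rightarrow> 'a" and \<mu> L :: real
  assumes gderiv: "\<And>x. GDERIV f x :> g x"
    and lipschitz: "\<And>x y. norm (g x - g y) \<le> L * norm (x - y)"
    and strong_convexity: "strongly_convex \<mu> f"
    and mu_pos: "\<mu> > 0"
begin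

text \<open>On the segment from \<open>x\<close> to \<open>y\<close>, the gap \<open>\<phi>\<close>
  in the strong convexity inequality is nonnegative and vanishes at 0, so its derivative there
  cannot be negative. That derivative is the right side of the claim minus the left side.\<close>

lemma above_tangent: "f x + inner (g x) (y - x) + \<mu> / 2 * (norm (y - x))\<^sup>2 \<le> f y"
proof (rule ccontr)
  define N where "N = (norm (y - x))\<^sup>2"
  define \<phi> where "\<phi> t = (1 - t) * f x + t * f y - \<mu> / 2 * t * (1 - t) * N - f (x + t *\<^sub>R (y - x))" for t
  assume "\<not> ?thesis"
  then have neg: "f y - f x - \<mu> / 2 * N - inner (y - x) (g x) < 0"
    by (simp add: N_def inner_commute)
  have "((\<lambda>t. f (x + t *\<^sub>R (y - x))) has_real_derivative inner (y - x) (g x)) (at 0)"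
    by (rule GDERIV_along_line) (simp add: gderiv)
  then have "(\<phi> has_real_derivative (f y - f x - \<mu> / 2 * N - inner (y - x) (g x))) (at 0)"
    unfolding \<phi>_def by (auto intro!: derivative_eq_intros)
  from DERIV_neg_dec_right[OF this neg] obtain e where "e > 0"
    and e: "\<And>h. 0 < h \<Longrightarrow> h < e \<Longrightarrow> \<phi> h < \<phi> 0"
    by auto
  define h where "h = min (e / 2) 1"
  have h: "0 < h" "h < e" "h \<le> 1"
    using \<open>e > 0\<close> by (auto simp: h_def)
  have "\<phi> h < 0"
    using e[OF h(1,2)] by (simp add: \<phi>_def)
  moreover have "f ((1 - h) *\<^sub>R x + h *\<^sub>R y)
      \<le> (1 - h) * f x + h * f y - \<mu> / 2 * h * (1 - h) * (norm (x - y))\<^sup>2"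
    using strong_convexity h unfolding strongly_convex_def by auto
  moreover have "(1 - h) *\<^sub>R x + h *\<^sub>R y = x + h *\<^sub>R (y - x)"
    by (simp add: algebra_simps)
  ultimately show False
    by (simp add: \<phi>_def N_def norm_minus_commute)
qed

lemma strongly_monotone: "\<mu> * (norm (x - y))\<^sup>2 \<le> inner (g x - g y) (x - y)"
  using above_tangent[of x y] above_tangent[of y x]
  by (simp add: algebra_simps norm_minus_commute)

text \<open>Strong monotonicity and the Lipschitz bound are compared at a unit vector, which a
  nonempty basis provides.\<close>

lemma mu_le_L: "\<mu> \<le> L"
proof -
  obtain b :: 'a where b: "b \<in> Basis"
    using nonempty_Basis by blast
  have "\<mu> * (norm (b - 0))\<^sup>2 \<le> norm (g b - g 0) * norm (b - 0)"
    using strongly_monotone norm_cauchy_schwarz by (rule order_trans)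
  also have "\<dots> \<le> L * norm (b - 0) * norm (b - 0)"
    by (intro mult_right_mono lipschitz) auto
  finally show ?thesis
    using b by simp
qed

lemma L_pos: "L > 0"
  using mu_le_L mu_pos by linarith

text \<open>The descent lemma: along the segment, the Lipschitz bound makes the difference between
  \<open>f\<close> and the parabola nonincreasing, and it is compared at the two ends.\<close>

lemma below_parabola: "f y \<le> f x + inner (g x) (y - x) + L / 2 * (norm (y - x))\<^sup>2"
proof -
  define d where "d = y - x"
  define \<phi> where "\<phi> t = f (x + t *\<^sub>R d) - t * inner d (g x) - L / 2 * t\<^sup>2 * (norm d)\<^sup>2" for t
  have "\<phi> 1 \<le> \<phi> 0"
  proof (rule DERIV_nonpos_imp_nonincreasing[where f = \<phi>])
    fix t :: real assume t: "0 \<le> t" "t \<le> 1"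
    have "((\<lambda>t. f (x + t *\<^sub>R d)) has_real_derivative inner d (g (x + t *\<^sub>R d))) (at t)"
      by (rule GDERIV_along_line) (rule gderiv)
    then have "(\<phi> has_real_derivative
        (inner d (g (x + t *\<^sub>R d)) - inner d (g x) - L * t * (norm d)\<^sup>2)) (at t)"
      unfolding \<phi>_def by (auto intro!: derivative_eq_intros)
    moreover have "inner d (g (x + t *\<^sub>R d)) - inner d (g x) \<le> L * t * (norm d)\<^sup>2"
    proof -
      have "inner d (g (x + t *\<^sub>R d)) - inner d (g x) = inner d (g (x + t *\<^sub>R d) - g x)"
        by (simp add: inner_diff_right)
      also have "\<dots> \<le> norm d * norm (g (x + t *\<^sub>R d) - g x)"
        by (rule norm_cauchy_schwarz)
      also have "\<dots> \<le> norm d * (L * norm (x + t *\<^sub>R d - x))"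
        by (intro mult_left_mono lipschitz) auto
      also have "\<dots> = L * t * (norm d)\<^sup>2"
        using t by (simp add: power2_eq_square)
      finally show ?thesis .
    qed
    ultimately show "\<exists>y. (\<phi> has_real_derivative y) (at t) \<and> y \<le> 0"
      by (metis diff_le_0_iff_le)
  qed simp
  then show ?thesis
    by (simp add: \<phi>_def d_def inner_commute)
qed

text \<open>The Baillon-Haddad theorem.\<close>

lemma cocoercive: "(norm (g x - g y))\<^sup>2 \<le> L * inner (g x - g y) (x - y)"
proof -
  \<comment> \<open>Compare \<open>f\<close> with its tangent at \<open>x\<close> at the point reached from \<open>y\<close> by a step of length \<open>1 / L\<close>.\<close>
  have *: "f x + inner (g x) (y - x) + (norm (g y - g x))\<^sup>2 / (2 * L) \<le> f y" for x y
  proof -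
    define G where "G = g y - g x"
    define z where "z = y - (1 / L) *\<^sub>R G"
    have "f x + inner (g x) (z - x) \<le> f z"
      using above_tangent[of x z] mu_pos
      by (smt (verit) mult_nonneg_nonneg zero_le_power2 divide_nonneg_nonneg)
    also have "f z \<le> f y + inner (g y) (z - y) + L / 2 * (norm (z - y))\<^sup>2"
      by (rule below_parabola)
    also have "(norm (z - y))\<^sup>2 = (norm G)\<^sup>2 / L\<^sup>2"
      by (simp add: z_def power_divide)
    also have "L / 2 * ((norm G)\<^sup>2 / L\<^sup>2) = (norm G)\<^sup>2 / (2 * L)"
      using L_pos by (simp add: power2_eq_square)
    finally have "f x + inner (g x) (z - x) - inner (g y) (z - y) \<le> f y + (norm G)\<^sup>2 / (2 * L)"
      by simp
    moreover have "inner (g x) (z - x) - inner (g y) (z - y) = inner (g x) (y - x) - inner G (z - y)"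
      by (simp add: G_def algebra_simps)
    moreover have "inner G (z - y) = - ((norm G)\<^sup>2 / L)"
      by (simp add: z_def power2_norm_eq_inner)
    ultimately show ?thesis
      unfolding G_def by (simp add: field_simps)
  qed
  \<comment> \<open>The function values cancel when the estimate is added to its copy with
    \<open>x\<close> and \<open>y\<close> exchanged.\<close>
  have "(norm (g x - g y))\<^sup>2 / L \<le> inner (g x - g y) (x - y)"
    using *[of x y] *[of y x] by (simp add: algebra_simps norm_minus_commute)
  then show ?thesis
    using L_pos by (simp add: field_simps)
qed

end

section \<open>Proximal points and the Moreau envelope of one client\<close>

text \<open>The proximal point of the function with gradient \<open>g\<close>, encoded by its
  stationarity equation; existence and uniqueness thus become a fixed point question.\<close>

definition prox :: "real \<Rightarrow> ('a::real_vector \<Rightarrow> 'a) \<Rightarrow> 'a \<Rightarrow> 'a" where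
  "prox lam g v = (THE x. g x = lam *\<^sub>R (v - x))"

locale regularized_client = smooth_strongly_convex +
  fixes lam :: real
  assumes lam_pos: "lam > 0"
begin

text \<open>A local step is a gradient step for the regularized loss. Its gradient is cocoercive
  with constant \<open>L + lam\<close>: the right side minus the left is the slack in the
  cocoercivity of \<open>g\<close> plus \<open>lam\<close> times the slack in
  \<open>G \<bullet> d \<le> L * (norm d)\<^sup>2\<close>.\<close>

lemma local_step_contraction:
  assumes "0 \<le> \<eta>" "\<eta> * (L + lam) \<le> 1"
  shows "(norm ((x - \<eta> *\<^sub>R (g x + lam *\<^sub>R (x - v))) - (y - \<eta> *\<^sub>R (g y + lam *\<^sub>R (y - v)))))\<^sup>2
    \<le> (1 - \<eta> * (\<mu> + lam)) * (norm (x - y))\<^sup>2"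
proof -
  define G where "G = g x - g y"
  define d where "d = x - y"
  have "G \<bullet> d \<le> L * (norm d)\<^sup>2"
  proof -
    have "G \<bullet> d \<le> norm G * norm d"
      by (rule norm_cauchy_schwarz)
    also have "\<dots> \<le> (L * norm d) * norm d"
      unfolding G_def d_def by (intro mult_right_mono lipschitz) auto
    finally show ?thesis
      by (simp add: power2_eq_square)
  qed
  then have "lam * (G \<bullet> d) \<le> lam * (L * (norm d)\<^sup>2)"
    using lam_pos by (intro mult_left_mono) auto
  moreover have "(norm G)\<^sup>2 \<le> L * (G \<bullet> d)"
    unfolding G_def d_def by (rule cocoercive)
  moreover have "(norm (G + lam *\<^sub>R d))\<^sup>2 = (norm G)\<^sup>2 + 2 * (lam * (G \<bullet> d)) + lam\<^sup>2 * (norm d)\<^sup>2"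
    unfolding power2_norm_eq_inner by (simp add: algebra_simps inner_commute power2_eq_square)
  moreover have "(L + lam) * ((G + lam *\<^sub>R d) \<bullet> d)
      = L * (G \<bullet> d) + lam * (G \<bullet> d) + lam * (L * (norm d)\<^sup>2) + lam\<^sup>2 * (norm d)\<^sup>2"
    unfolding power2_norm_eq_inner by (simp add: algebra_simps power2_eq_square)
  ultimately have "(norm (G + lam *\<^sub>R d))\<^sup>2 \<le> (L + lam) * ((G + lam *\<^sub>R d) \<bullet> d)"
    by linarith
  moreover have "(\<mu> + lam) * (norm d)\<^sup>2 \<le> (G + lam *\<^sub>R d) \<bullet> d"
    using strongly_monotone[of x y]
    by (simp add: G_def d_def inner_add_left power2_norm_eq_inner algebra_simps)
  ultimately have "(norm (d - \<eta> *\<^sub>R (G + lam *\<^sub>R d)))\<^sup>2 \<le> (1 - \<eta> * (\<mu> + lam)) * (norm d)\<^sup>2"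
    using assms lam_pos mu_pos by (intro gradient_step_contraction[where M = "L + lam"]) auto
  then show ?thesis
    by (simp add: G_def d_def algebra_simps)
qed

text \<open>The solutions are the fixed points of a local step with step size
  \<open>1 / (L + lam)\<close>, so Banach's fixed point theorem applies.\<close>

lemma prox_unique_existence: "\<exists>!x. g x = lam *\<^sub>R (v - x)"
proof -
  define \<eta> where "\<eta> = 1 / (L + lam)"
  define \<beta> where "\<beta> = 1 - \<eta> * (\<mu> + lam)"
  have \<eta>: "\<eta> > 0" "\<eta> * (L + lam) = 1"
    using L_pos lam_pos by (auto simp: \<eta>_def)
  have "\<eta> * (\<mu> + lam) \<le> \<eta> * (L + lam)"
    using \<eta> mu_le_L by (intro mult_left_mono) auto
  moreover have "0 < \<eta> * (\<mu> + lam)"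
    using \<eta> mu_pos lam_pos by auto
  ultimately have \<beta>: "0 \<le> \<beta>" "\<beta> < 1"
    unfolding \<beta>_def \<eta> by auto
  define T where "T x = x - \<eta> *\<^sub>R (g x + lam *\<^sub>R (x - v))" for x
  have "dist (T x) (T y) \<le> sqrt \<beta> * dist x y" for x y
  proof -
    have "(dist (T x) (T y))\<^sup>2 \<le> \<beta> * (dist x y)\<^sup>2"
      unfolding T_def dist_norm \<beta>_def using \<eta> by (intro local_step_contraction) auto
    then have "sqrt ((dist (T x) (T y))\<^sup>2) \<le> sqrt (\<beta> * (dist x y)\<^sup>2)"
      by (rule real_sqrt_le_mono)
    then show ?thesis
      by (simp add: real_sqrt_mult)
  qed
  then have "\<exists>!x. T x = x"
    using \<beta> by (intro banach_fix_type[where c = "sqrt \<beta>"]) auto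
  moreover have "T x = x \<longleftrightarrow> g x = lam *\<^sub>R (v - x)" for x
  proof -
    have "T x = x \<longleftrightarrow> g x + lam *\<^sub>R (x - v) = 0"
      using \<eta> by (simp add: T_def)
    also have "\<dots> \<longleftrightarrow> g x = lam *\<^sub>R (v - x)"
      by (auto simp: algebra_simps eq_neg_iff_add_eq_0)
    finally show ?thesis .
  qed
  ultimately show ?thesis
    by simp
qed

lemma gradient_prox: "g (prox lam g v) = lam *\<^sub>R (v - prox lam g v)"
  unfolding prox_def by (rule theI') (rule prox_unique_existence)

lemma prox_eqI: "g x = lam *\<^sub>R (v - x) \<Longrightarrow> prox lam g v = x"
  using prox_unique_existence gradient_prox by blast

lemma prox_step_fixpoint:
  "prox lam g v - \<eta> *\<^sub>R (g (prox lam g v) + lam *\<^sub>R (prox lam g v - v)) = prox lam g v"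
  by (simp add: gradient_prox algebra_simps)

text \<open>Every local step fixes the proximal point, so each one contracts the squared distance to
  it. The root is taken once at the end.\<close>

lemma local_steps_contraction:
  assumes "0 \<le> \<eta>" "\<eta> * (L + lam) \<le> 1"
    and step: "\<And>k. k < K \<Longrightarrow> x (k + 1) = x k - \<eta> *\<^sub>R (g (x k) + lam *\<^sub>R (x k - v))"
  shows "norm (x K - prox lam g v) \<le> sqrt ((1 - \<eta> * (\<mu> + lam)) ^ K) * norm (x 0 - prox lam g v)"
proof -
  define \<beta> where "\<beta> = 1 - \<eta> * (\<mu> + lam)"
  have "\<eta> * (\<mu> + lam) \<le> \<eta> * (L + lam)"
    using assms mu_le_L by (intro mult_left_mono) auto
  then have "0 \<le> \<beta>"
    using assms by (simp add: \<beta>_def)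
  have "k \<le> K \<Longrightarrow> (norm (x k - prox lam g v))\<^sup>2 \<le> \<beta> ^ k * (norm (x 0 - prox lam g v))\<^sup>2" for k
  proof (induction k)
    case (Suc k)
    have "(norm (x (k + 1) - prox lam g v))\<^sup>2 \<le> \<beta> * (norm (x k - prox lam g v))\<^sup>2"
      using local_step_contraction[OF assms(1,2), of "x k" v "prox lam g v"] step[of k] Suc.prems
      by (simp add: prox_step_fixpoint \<beta>_def)
    also have "\<dots> \<le> \<beta> * (\<beta> ^ k * (norm (x 0 - prox lam g v))\<^sup>2)"
      using Suc \<open>0 \<le> \<beta>\<close> by (intro mult_left_mono) auto
    finally show ?case
      by simp
  qed simp
  from this[of K] have "sqrt ((norm (x K - prox lam g v))\<^sup>2)
      \<le> sqrt (\<beta> ^ K * (norm (x 0 - prox lam g v))\<^sup>2)"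
    by (intro real_sqrt_le_mono) auto
  then show ?thesis
    by (simp add: real_sqrt_mult \<beta>_def)
qed

text \<open>Stationarity turns the difference of the gradients at the two proximal points into
  \<open>lam\<close> times \<open>d - e\<close>; strong monotonicity and Cauchy-Schwarz then bound
  \<open>e\<close> by \<open>d\<close>. The constant is \<open>L_w\<close>.\<close>

lemma prox_lipschitz: "norm (prox lam g v - prox lam g v') \<le> lam / (lam + \<mu>) * norm (v - v')"
proof -
  define e where "e = prox lam g v - prox lam g v'"
  define d where "d = v - v'"
  have "g (prox lam g v) - g (prox lam g v') = lam *\<^sub>R (d - e)"
    by (simp add: gradient_prox e_def d_def algebra_simps)
  then have "\<mu> * (norm e)\<^sup>2 \<le> (lam *\<^sub>R (d - e)) \<bullet> e"
    using strongly_monotone[of "prox lam g v" "prox lam g v'"] by (simp add: e_def)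
  then have "(lam + \<mu>) * (norm e)\<^sup>2 \<le> lam * (d \<bullet> e)"
    by (simp add: inner_diff_left power2_norm_eq_inner algebra_simps)
  also have "\<dots> \<le> lam * (norm d * norm e)"
    using lam_pos by (intro mult_left_mono norm_cauchy_schwarz) auto
  finally have "((lam + \<mu>) * norm e) * norm e \<le> (lam * norm d) * norm e"
    by (simp add: power2_eq_square algebra_simps)
  then have "(lam + \<mu>) * norm e \<le> lam * norm d"
    using lam_pos by (cases "norm e = 0") (auto simp: mult_le_cancel_right)
  then show ?thesis
    using lam_pos mu_pos by (simp add: e_def d_def field_simps)
qed

text \<open>The proximal points take back at most the fraction \<open>L_w\<close> of the
  displacement, and \<open>lam * (1 - L_w)\<close> equals \<open>mu_g\<close>.\<close>

lemma envelope_gradient_strongly_monotone: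
  "lam * \<mu> / (lam + \<mu>) * (norm (v - v'))\<^sup>2
    \<le> (lam *\<^sub>R ((v - prox lam g v) - (v' - prox lam g v'))) \<bullet> (v - v')"
proof -
  define e where "e = prox lam g v - prox lam g v'"
  define d where "d = v - v'"
  have "e \<bullet> d \<le> norm e * norm d"
    by (rule norm_cauchy_schwarz)
  also have "\<dots> \<le> (lam / (lam + \<mu>) * norm d) * norm d"
    unfolding e_def d_def by (intro mult_right_mono prox_lipschitz) auto
  finally have "lam * (e \<bullet> d) \<le> lam * (lam / (lam + \<mu>) * (norm d)\<^sup>2)"
    using lam_pos by (intro mult_left_mono) (auto simp: power2_eq_square)
  moreover have "(lam *\<^sub>R ((v - prox lam g v) - (v' - prox lam g v'))) \<bullet> (v - v')
      = lam * (norm d)\<^sup>2 - lam * (e \<bullet> d)"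
    by (simp add: e_def d_def power2_norm_eq_inner algebra_simps)
  moreover have "lam * \<mu> / (lam + \<mu>) * (norm d)\<^sup>2
      = lam * (norm d)\<^sup>2 - lam * (lam / (lam + \<mu>) * (norm d)\<^sup>2)"
    using lam_pos mu_pos by (simp add: field_simps)
  ultimately show ?thesis
    unfolding d_def by linarith
qed

text \<open>\<open>G\<close> is also the difference of \<open>g\<close> at the proximal points,
  hence cocoercive with respect to \<open>e\<close>, and \<open>e\<close> is \<open>d\<close> minus
  \<open>G / lam\<close>. So the reciprocals of the constants add up:
  \<open>1 / L_g = 1 / L + 1 / lam\<close>.\<close>

lemma envelope_gradient_cocoercive:
  "(norm (lam *\<^sub>R ((v - prox lam g v) - (v' - prox lam g v'))))\<^sup>2
    \<le> lam * L / (lam + L) * ((lam *\<^sub>R ((v - prox lam g v) - (v' - prox lam g v'))) \<bullet> (v - v'))"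
proof -
  define e where "e = prox lam g v - prox lam g v'"
  define d where "d = v - v'"
  define G where "G = lam *\<^sub>R ((v - prox lam g v) - (v' - prox lam g v'))"
  have G: "G = lam *\<^sub>R (d - e)"
    by (simp add: G_def d_def e_def algebra_simps)
  have "G = g (prox lam g v) - g (prox lam g v')"
    by (simp add: gradient_prox G_def algebra_simps)
  then have "(norm G)\<^sup>2 \<le> L * (G \<bullet> e)"
    using cocoercive[of "prox lam g v" "prox lam g v'"] by (simp add: e_def)
  then have "lam * (norm G)\<^sup>2 \<le> lam * (L * (G \<bullet> e))"
    using lam_pos by (intro mult_left_mono) auto
  moreover have "(norm G)\<^sup>2 = lam * (G \<bullet> d) - lam * (G \<bullet> e)"
    unfolding power2_norm_eq_inner by (subst (2) G) (simp add: inner_diff_right algebra_simps)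
  then have "L * (norm G)\<^sup>2 = lam * L * (G \<bullet> d) - lam * (L * (G \<bullet> e))"
    by (simp add: right_diff_distrib mult.left_commute mult.assoc)
  ultimately have "(lam + L) * (norm G)\<^sup>2 \<le> lam * L * (G \<bullet> d)"
    by (simp add: algebra_simps)
  then show ?thesis
    unfolding G_def[symmetric] d_def[symmetric] using lam_pos L_pos by (simp add: field_simps)
qed

end

section \<open>Averages over clients, and stationarity of the minimizer\<close>

lemma norm_sum_square_le:
  fixes G :: "'i \<Rightarrow> 'a::real_normed_vector"
  shows "(norm (\<Sum>i\<in>I. G i))\<^sup>2 \<le> real (card I) * (\<Sum>i\<in>I. (norm (G i))\<^sup>2)"
proof -
  have "(norm (\<Sum>i\<in>I. G i))\<^sup>2 \<le> (\<Sum>i\<in>I. norm (G i))\<^sup>2"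
    by (intro power_mono norm_sum) auto
  also have "\<dots> \<le> (\<Sum>i\<in>I. 1\<^sup>2) * (\<Sum>i\<in>I. (norm (G i))\<^sup>2)"
    using Cauchy_Schwarz_ineq_sum[of "\<lambda>_. 1" "\<lambda>i. norm (G i)" I] by simp
  finally show ?thesis
    by simp
qed

text \<open>The first bound is linear in \<open>G\<close>. The second survives with the same
  constant because the squared norm of an average is at most the average of the squared
  norms.\<close>

lemma monotone_average:
  fixes G :: "nat \<Rightarrow> 'a::real_inner"
  assumes "m \<ge> 1"
    and "\<And>i. i \<in> {1..m} \<Longrightarrow> c * (norm d)\<^sup>2 \<le> G i \<bullet> d"
    and "\<And>i. i \<in> {1..m} \<Longrightarrow> (norm (G i))\<^sup>2 \<le> M * (G i \<bullet> d)"
  shows "c * (norm d)\<^sup>2 \<le> ((1 / real m) *\<^sub>R (\<Sum>i=1..m. G i)) \<bullet> d"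
    and "(norm ((1 / real m) *\<^sub>R (\<Sum>i=1..m. G i)))\<^sup>2
      \<le> M * (((1 / real m) *\<^sub>R (\<Sum>i=1..m. G i)) \<bullet> d)"
proof -
  have "(\<Sum>i=1..m. c * (norm d)\<^sup>2) \<le> (\<Sum>i=1..m. G i \<bullet> d)"
    by (rule sum_mono) (rule assms)
  then show "c * (norm d)\<^sup>2 \<le> ((1 / real m) *\<^sub>R (\<Sum>i=1..m. G i)) \<bullet> d"
    using \<open>m \<ge> 1\<close> by (simp add: inner_sum_left field_simps)
  have "(norm (\<Sum>i=1..m. G i))\<^sup>2 \<le> real m * (\<Sum>i=1..m. (norm (G i))\<^sup>2)"
    using norm_sum_square_le[of G "{1..m}"] by simp
  also have "\<dots> \<le> real m * (\<Sum>i=1..m. M * (G i \<bullet> d))"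
    by (intro mult_left_mono sum_mono assms) auto
  finally have "(norm (\<Sum>i=1..m. G i))\<^sup>2 / (real m)\<^sup>2
      \<le> real m * (\<Sum>i=1..m. M * (G i \<bullet> d)) / (real m)\<^sup>2"
    by (rule divide_right_mono) simp
  also have "\<dots> = M * ((\<Sum>i=1..m. G i) \<bullet> d) / real m"
    using \<open>m \<ge> 1\<close> by (simp add: power2_eq_square inner_sum_left flip: sum_distrib_left)
  finally show "(norm ((1 / real m) *\<^sub>R (\<Sum>i=1..m. G i)))\<^sup>2
      \<le> M * (((1 / real m) *\<^sub>R (\<Sum>i=1..m. G i)) \<bullet> d)"
    by (simp add: power_divide)
qed

lemma client_loss_GDERIV:
  fixes l :: "'a::euclidean_space \<Rightarrow> 'z \<Rightarrow> real"
  assumes "\<And>x a. (\<lambda>x. l x a) differentiable (at x)"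
  shows "GDERIV (client_loss l n z i) x :>
    (1 / real (n i)) *\<^sub>R (\<Sum>j=1..n i. gradient (\<lambda>x. l x (z i j)) x)"
  unfolding client_loss_def[abs_def]
  by (intro GDERIV_cmult GDERIV_sum GDERIV_gradient assms)

lemma client_loss_smooth:
  fixes l :: "'a::euclidean_space \<Rightarrow> 'z \<Rightarrow> real"
  assumes "n i \<ge> 1"
    and "\<And>x a. (\<lambda>x. l x a) differentiable (at x)"
    and "\<And>x y a. norm (gradient (\<lambda>x. l x a) x - gradient (\<lambda>x. l x a) y) \<le> L * norm (x - y)"
  shows "norm (gradient (client_loss l n z i) x - gradient (client_loss l n z i) y) \<le> L * norm (x - y)"
proof -
  let ?h = "\<lambda>j x. gradient (\<lambda>x. l x (z i j)) x"
  have "gradient (client_loss l n z i) x - gradient (client_loss l n z i) y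
      = (1 / real (n i)) *\<^sub>R (\<Sum>j=1..n i. ?h j x - ?h j y)"
    by (simp add: gradient_eqI[OF client_loss_GDERIV[OF assms(2)]] sum_subtractf scaleR_diff_right)
  also have "norm \<dots> = (1 / real (n i)) * norm (\<Sum>j=1..n i. ?h j x - ?h j y)"
    by simp
  also have "\<dots> \<le> (1 / real (n i)) * (\<Sum>j=1..n i. L * norm (x - y))"
    by (intro mult_left_mono sum_norm_le assms) auto
  also have "\<dots> = L * norm (x - y)"
    using \<open>n i \<ge> 1\<close> by simp
  finally show ?thesis .
qed

text \<open>A joint minimizer is minimal in each block of variables while the others are held fixed:
  once for a single local model, once for the global model.\<close>

lemma fed_minimizer_stationary:
  fixes F :: "nat \<Rightarrow> 'a::real_inner \<Rightarrow> real"
  assumes "m \<ge> 1" and "lam > 0"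
    and min: "is_arg_min (fed_objective lam m F) (\<lambda>_. True) (wg_min, w_min)"
    and F: "\<And>i x. i \<in> {1..m} \<Longrightarrow> GDERIV (F i) x :> g i x"
  shows "i \<in> {1..m} \<Longrightarrow> g i (w_min i) = lam *\<^sub>R (wg_min - w_min i)"
    and "(\<Sum>i=1..m. lam *\<^sub>R (wg_min - w_min i)) = 0"
proof -
  let ?h = "\<lambda>i. client_objective lam (F i)"
  have le: "(\<Sum>i=1..m. ?h i (w_min i) wg_min) \<le> (\<Sum>i=1..m. ?h i (w i) v)" for v w
  proof -
    have "fed_objective lam m F (wg_min, w_min) \<le> fed_objective lam m F (v, w)"
      using min unfolding is_arg_min_def by (metis linorder_not_le)
    then show ?thesis
      using \<open>m \<ge> 1\<close> by (simp add: fed_objective_def divide_le_cancel)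
  qed
  show "g i (w_min i) = lam *\<^sub>R (wg_min - w_min i)" if i: "i \<in> {1..m}"
  proof -
    have "?h i (w_min i) wg_min \<le> ?h i y wg_min" for y
    proof -
      \<comment> \<open>Only the summand of client \<open>i\<close> changes, so the others cancel in
        the comparison.\<close>
      have "(\<Sum>j=1..m. ?h j ((w_min(i := y)) j) wg_min)
          = ?h i y wg_min + (\<Sum>j\<in>{1..m} - {i}. ?h j (w_min j) wg_min)"
        using i by (subst sum.remove[of _ i]) auto
      moreover have "(\<Sum>j=1..m. ?h j (w_min j) wg_min)
          = ?h i (w_min i) wg_min + (\<Sum>j\<in>{1..m} - {i}. ?h j (w_min j) wg_min)"
        using i by (subst sum.remove[of _ i]) auto
      ultimately show ?thesis
        using le[where v = wg_min and w = "w_min(i := y)"] by linarith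
    qed
    moreover have "GDERIV (\<lambda>y. ?h i y wg_min) (w_min i) :>
        g i (w_min i) + (lam / 2) *\<^sub>R (2 *\<^sub>R (w_min i - wg_min))"
      unfolding client_objective_def
      by (intro GDERIV_add GDERIV_cmult F[OF i] GDERIV_norm_diff_square)
    ultimately have "g i (w_min i) + (lam / 2) *\<^sub>R (2 *\<^sub>R (w_min i - wg_min)) = 0"
      by (rule GDERIV_minimum[rotated])
    then show ?thesis
      by (simp add: algebra_simps eq_neg_iff_add_eq_0)
  qed
  have "GDERIV (\<lambda>v. \<Sum>i=1..m. F i (w_min i) + lam / 2 * (norm (w_min i - v))\<^sup>2) wg_min :>
      (\<Sum>i=1..m. 0 + (lam / 2) *\<^sub>R (2 *\<^sub>R (wg_min - w_min i)))"
    by (intro GDERIV_sum GDERIV_add GDERIV_const GDERIV_cmult GDERIV_norm_diff_square)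
  then have "(\<Sum>i=1..m. 0 + (lam / 2) *\<^sub>R (2 *\<^sub>R (wg_min - w_min i))) = 0"
    using le[where w = w_min] by (intro GDERIV_minimum) (auto simp: client_objective_def norm_minus_commute)
  then show "(\<Sum>i=1..m. lam *\<^sub>R (wg_min - w_min i)) = 0"
    by simp
qed

section \<open>Estimates behind the contraction factor\<close>

text \<open>In the application \<open>\<kappa> = lam / \<mu>\<close>, \<open>q = \<gamma> mu_g\<close>, \<open>s = \<gamma> L_g\<close>, and \<open>\<rho>\<close> is the contraction factor of
  \<open>K\<close> local steps. The two inequalities say that the recursion matrix of \<open>(D t, E t)\<close> has
  \<open>(1, b)\<close> as a left subsolution for the factor \<open>\<theta>\<close>.\<close>

lemma coupled_recursion_rate:
  fixes \<kappa> q s \<rho> :: real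
  assumes "0 \<le> \<kappa>" "0 < q" "q \<le> s" "s < 1" "0 \<le> \<rho>"
    and \<rho>: "(2 + 64 * \<kappa>\<^sup>2) * \<rho>\<^sup>2 \<le> (1 - s) ^ 4"
  defines "u \<equiv> sqrt (1 - q)" and "\<theta> \<equiv> sqrt (1 - q / 2 - q\<^sup>2 / 2)"
  defines "b \<equiv> 4 * q * (1 + \<kappa>) / u"
  shows "u + b * (\<rho> * (\<kappa> / (1 + \<kappa>) * s)) \<le> \<theta>"
    and "q * (1 + \<kappa>) + b * (\<rho> * (1 + q * \<kappa>)) \<le> b * \<theta>"
proof -
  have q: "q < 1" and s: "0 < s"
    using assms by auto
  have u: "0 < u" "u\<^sup>2 = 1 - q" "u \<le> 1"
    using assms by (auto simp: u_def)
  \<comment> \<open>The claimed rate factors as \<open>(1 - q) * (1 + q / 2)\<close>. The resulting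
    surplus of \<open>\<theta>\<close> over \<open>u\<close> has to absorb the part of the global
    error that enters the next local error.\<close>
  have "u * (1 + q / 5) \<le> \<theta>"
    unfolding \<theta>_def
  proof (rule real_le_rsqrt)
    have "q\<^sup>2 \<le> 1 * q"
      unfolding power2_eq_square using q assms by (intro mult_right_mono) auto
    moreover have "(1 + q / 5)\<^sup>2 = 1 + 2 / 5 * q + q\<^sup>2 / 25"
      by (simp add: power2_eq_square field_simps)
    ultimately have "(1 + q / 5)\<^sup>2 \<le> 1 + q / 2"
      using assms by simp
    then have "(1 - q) * (1 + q / 5)\<^sup>2 \<le> (1 - q) * (1 + q / 2)"
      using q by (intro mult_left_mono) auto
    then have "(u * (1 + q / 5))\<^sup>2 \<le> (1 - q) * (1 + q / 2)"
      by (simp add: power_mult_distrib u)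
    also have "\<dots> = 1 - q / 2 - q\<^sup>2 / 2"
      by (simp add: power2_eq_square field_simps)
    finally show "(u * (1 + q / 5))\<^sup>2 \<le> 1 - q / 2 - q\<^sup>2 / 2" .
  qed
  moreover have "0 \<le> u * (q / 5)"
    using u assms by auto
  ultimately have \<theta>: "u + u * (q / 5) \<le> \<theta>" "u \<le> \<theta>"
    by (auto simp: algebra_simps)
  have b: "0 < b"
    using u assms by (simp add: b_def)
  have "1 - s \<le> u\<^sup>2"
    using u assms by simp
  also have "u\<^sup>2 \<le> 1 * u"
    unfolding power2_eq_square using u by (intro mult_right_mono) auto
  finally have su: "1 - s \<le> u"
    by simp
  have s4: "(1 - s) ^ 4 = ((1 - s)\<^sup>2)\<^sup>2"
    by (simp flip: power_mult)
  \<comment> \<open>The summand \<open>64 * \<kappa>\<^sup>2\<close> of the condition on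
    \<open>\<rho>\<close> controls the coupling term.\<close>
  have "(8 * (\<kappa> * \<rho>))\<^sup>2 \<le> (2 + 64 * \<kappa>\<^sup>2) * \<rho>\<^sup>2"
    by (simp add: power_mult_distrib algebra_simps)
  then have "(8 * (\<kappa> * \<rho>))\<^sup>2 \<le> ((1 - s)\<^sup>2)\<^sup>2"
    using \<rho> unfolding s4 by linarith
  then have \<kappa>\<rho>: "8 * (\<kappa> * \<rho>) \<le> (1 - s)\<^sup>2"
    by (rule power2_le_imp_le) simp
  \<comment> \<open>A sum of squares certificate; \<open>9 / 16\<close> is the square of
    \<open>3 / 4\<close>, which leaves a quarter of \<open>u\<close> to spare below.\<close>
  have "9 / 16 * (2 + 64 * \<kappa>\<^sup>2) = (1 + \<kappa>)\<^sup>2 + (4 * \<kappa> - 1 / 4)\<^sup>2 + 19 * \<kappa>\<^sup>2 + 1 / 16"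
    by (simp add: power2_eq_square field_simps)
  then have "(1 + \<kappa>)\<^sup>2 \<le> 9 / 16 * (2 + 64 * \<kappa>\<^sup>2)"
    using zero_le_power2[of "4 * \<kappa> - 1 / 4"] zero_le_power2[of \<kappa>] by linarith
  then have "(1 + \<kappa>)\<^sup>2 * \<rho>\<^sup>2 \<le> 9 / 16 * (2 + 64 * \<kappa>\<^sup>2) * \<rho>\<^sup>2"
    by (intro mult_right_mono) auto
  also have "\<dots> \<le> 9 / 16 * ((1 - s)\<^sup>2)\<^sup>2"
    using \<rho> unfolding s4 by linarith
  also have "\<dots> = (3 / 4 * (1 - s)\<^sup>2)\<^sup>2"
    by (simp add: power_mult_distrib power_divide)
  finally have "((1 + \<kappa>) * \<rho>)\<^sup>2 \<le> (3 / 4 * (1 - s)\<^sup>2)\<^sup>2"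
    by (simp add: power_mult_distrib)
  then have "(1 + \<kappa>) * \<rho> \<le> 3 / 4 * (1 - s)\<^sup>2"
    by (rule power2_le_imp_le) simp
  moreover have "(1 - s)\<^sup>2 \<le> 1 - s"
    unfolding power2_eq_square using s assms by (intro mult_left_le) auto
  moreover have "\<rho> * (1 + q * \<kappa>) \<le> \<rho> * (1 + \<kappa>)"
    using q assms by (intro mult_left_mono) (auto simp: mult_left_le_one_le)
  ultimately have "\<rho> * (1 + q * \<kappa>) \<le> 3 / 4 * u"
    using su by (simp add: mult.commute)
  then have "b * (\<rho> * (1 + q * \<kappa>)) \<le> b * (\<theta> - u / 4)"
    using \<theta>(2) b by (intro mult_left_mono) linarith+
  \<comment> \<open>The weight \<open>b\<close> is chosen for this identity: the spare quarter of
    \<open>u\<close> pays exactly for the effect of the local error on the global one.\<close>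
  moreover have "b * (u / 4) = q * (1 + \<kappa>)"
    using u by (simp add: b_def)
  ultimately show "q * (1 + \<kappa>) + b * (\<rho> * (1 + q * \<kappa>)) \<le> b * \<theta>"
    unfolding right_diff_distrib by linarith
  have "1 + \<kappa> \<noteq> 0"
    using assms by simp
  \<comment> \<open>Multiplication by \<open>u\<close> clears the denominator of \<open>b\<close>,
    so the target becomes \<open>u * (u * (q / 5))\<close>.\<close>
  have "u * (b * (\<rho> * (\<kappa> / (1 + \<kappa>) * s))) = q * s * (4 * (\<kappa> * \<rho>))"
    using u \<open>1 + \<kappa> \<noteq> 0\<close> by (simp add: b_def)
  also have "\<dots> \<le> q * s * ((1 - s)\<^sup>2 / 2)"
    using \<kappa>\<rho> s assms by (intro mult_left_mono) auto
  also have "\<dots> = (q / 2) * (s * (1 - s)) * (1 - s)"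
    by (simp add: power2_eq_square)
  \<comment> \<open>One factor \<open>1 - s\<close> is paired with \<open>s\<close>; the other is
    bounded by \<open>u\<^sup>2\<close>.\<close>
  also have "\<dots> \<le> (q / 2) * (1 / 4) * u\<^sup>2"
  proof (intro mult_mono mult_nonneg_nonneg)
    have "0 \<le> (s - 1 / 2)\<^sup>2"
      by simp
    then show "s * (1 - s) \<le> 1 / 4"
      by (simp add: power2_eq_square algebra_simps)
  qed (use \<open>1 - s \<le> u\<^sup>2\<close> s assms in auto)
  also have "\<dots> = q * u\<^sup>2 / 8"
    by simp
  also have "\<dots> \<le> q * u\<^sup>2 / 5"
    using \<open>0 < q\<close> by (intro divide_left_mono) auto
  also have "\<dots> = u * (u * (q / 5))"
    by (simp add: power2_eq_square)
  finally have "b * (\<rho> * (\<kappa> / (1 + \<kappa>) * s)) \<le> u * (q / 5)"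
    by (rule mult_left_le_imp_le) (rule u)
  then show "u + b * (\<rho> * (\<kappa> / (1 + \<kappa>) * s)) \<le> \<theta>"
    using \<theta> by linarith
qed

theorem theorem2:
  fixes l :: "real ^ 'd \<Rightarrow> 'z \<Rightarrow> real"
    and m K :: nat and n :: "nat \<Rightarrow> nat" and z :: "nat \<Rightarrow> nat \<Rightarrow> 'z"
    and lam L \<mu> \<eta> \<gamma> :: real
    and wg :: "nat \<Rightarrow> real ^ 'd" and w :: "nat \<Rightarrow> nat \<Rightarrow> nat \<Rightarrow> real ^ 'd"
    and wg_min :: "real ^ 'd" and w_min :: "nat \<Rightarrow> real ^ 'd"
  assumes "m \<ge> 1" and "\<And>i. i \<in> {1..m} \<Longrightarrow> n i \<ge> 1"
    and differentiable: "\<And>x a. (\<lambda>x. l x a) differentiable (at x)"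
    and smooth: "\<And>x y a. norm (gradient (\<lambda>x. l x a) x - gradient (\<lambda>x. l x a) y) \<le> L * norm (x - y)"
    and "\<mu> > 0"
    and strongly_convex: "\<And>i. i \<in> {1..m} \<Longrightarrow> strongly_convex \<mu> (client_loss l n z i)"
    and "lam > 0"
    and minimizer: "is_arg_min (fed_objective lam m (client_loss l n z)) (\<lambda>_. True) (wg_min, w_min)"
    and algorithm: "fed_gd lam \<eta> \<gamma> K m (client_loss l n z) wg w"
    and "0 < \<gamma>" "\<gamma> < 1 / L_g lam L"
    and "0 < \<eta>" "\<eta> \<le> 1 / L_l lam L"
    and inner_iterations:
      "(2 + 64 * (L_w lam \<mu>)\<^sup>2 * (1 / mu_g lam \<mu>)\<^sup>2 * lam\<^sup>2) * (1 - \<eta> * mu_l lam \<mu>) ^ K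
         \<le> (1 - \<gamma> * L_g lam L) ^ 4"
  shows "converges_linearly wg wg_min (1 - \<gamma> * mu_g lam \<mu> / 2 - (\<gamma> * mu_g lam \<mu>)\<^sup>2 / 2) \<and>
    (\<forall>i\<in>{1..m}.
      converges_linearly (\<lambda>t. w i t 0) (w_min i) (1 - \<gamma> * mu_g lam \<mu> / 2 - (\<gamma> * mu_g lam \<mu>)\<^sup>2 / 2))"
proof -
  define F where "F = client_loss l n z"
  define g where "g i = gradient (F i)" for i
  define p where "p i = prox lam (g i)" for i
  have client: "regularized_client (F i) (g i) \<mu> L lam" if "i \<in> {1..m}" for i
  proof unfold_locales
    show "GDERIV (F i) x :> g i x" for x
      unfolding F_def g_def gradient_eqI[OF client_loss_GDERIV[OF differentiable]]
      by (rule client_loss_GDERIV[OF differentiable])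
    show "norm (g i x - g i y) \<le> L * norm (x - y)" for x y
      unfolding F_def g_def using assms(2)[OF that] by (intro client_loss_smooth differentiable smooth)
  qed (use assms that in \<open>auto simp: F_def\<close>)
  \<comment> \<open>Some client exists because \<open>m \<ge> 1\<close>; it supplies
    \<open>\<mu> \<le> L\<close> and \<open>0 < L\<close>.\<close>
  interpret client1: regularized_client "F 1" "g 1" \<mu> L lam
    using \<open>m \<ge> 1\<close> by (intro client) simp
  note L = client1.mu_le_L client1.L_pos

  \<comment> \<open>Constants of the recursion\<close>
  define \<kappa> where "\<kappa> = lam / \<mu>"
  define q where "q = \<gamma> * mu_g lam \<mu>"
  define s where "s = \<gamma> * L_g lam L"
  define \<rho> where "\<rho> = sqrt ((1 - \<eta> * (\<mu> + lam)) ^ K)"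
  have pos: "mu_g lam \<mu> > 0" "L_g lam L > 0"
    using L \<open>\<mu> > 0\<close> \<open>lam > 0\<close> by (simp_all add: mu_g_def L_g_def)
  have "lam * \<mu> * (lam + L) \<le> lam * L * (lam + \<mu>)"
    using L \<open>lam > 0\<close> by (simp add: algebra_simps)
  then have "mu_g lam \<mu> \<le> L_g lam L"
    using L \<open>\<mu> > 0\<close> \<open>lam > 0\<close>
    by (simp add: mu_g_def L_g_def pos_le_divide_eq pos_divide_le_eq)
  then have q: "0 < q" "q \<le> s"
    using pos \<open>0 < \<gamma>\<close> by (simp_all add: q_def s_def)
  have s: "s < 1"
    using pos \<open>\<gamma> < 1 / L_g lam L\<close> by (simp add: s_def pos_less_divide_eq)
  have \<kappa>: "0 \<le> \<kappa>"
    using \<open>\<mu> > 0\<close> \<open>lam > 0\<close> by (simp add: \<kappa>_def)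
  have "1 + \<kappa> = (lam + \<mu>) / \<mu>"
    using \<open>\<mu> > 0\<close> by (simp add: \<kappa>_def add_divide_distrib)
  then have \<gamma>lam: "\<gamma> * lam = q * (1 + \<kappa>)" and L_w: "lam / (lam + \<mu>) = \<kappa> / (1 + \<kappa>)"
    using \<open>\<mu> > 0\<close> \<open>lam > 0\<close> by (simp_all add: q_def \<kappa>_def mu_g_def)
  have \<eta>: "0 \<le> \<eta>" "\<eta> * (L + lam) \<le> 1"
    using \<open>0 < \<eta>\<close> \<open>\<eta> \<le> 1 / L_l lam L\<close> L \<open>lam > 0\<close> by (simp_all add: L_l_def pos_le_divide_eq)
  moreover have "\<eta> * (\<mu> + lam) \<le> \<eta> * (L + lam)"
    using \<eta> L by (intro mult_left_mono) auto
  ultimately have \<beta>: "0 \<le> (1 - \<eta> * (\<mu> + lam)) ^ K"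
    by simp
  then have \<rho>: "0 \<le> \<rho>" "\<rho>\<^sup>2 = (1 - \<eta> * (\<mu> + lam)) ^ K"
    by (auto simp: \<rho>_def)
  \<comment> \<open>The problem constants collapse to \<open>lam / \<mu>\<close>, which brings the
    condition on \<open>K\<close> into the form used by
    \<open>coupled_recursion_rate\<close>.\<close>
  have "L_w lam \<mu> * (1 / mu_g lam \<mu>) * lam = \<kappa>"
    using \<open>\<mu> > 0\<close> \<open>lam > 0\<close> by (simp add: L_w_def mu_g_def \<kappa>_def)
  then have "64 * (L_w lam \<mu>)\<^sup>2 * (1 / mu_g lam \<mu>)\<^sup>2 * lam\<^sup>2 = 64 * \<kappa>\<^sup>2"
    by (simp only: power_mult_distrib mult.assoc flip: \<open>_ = \<kappa>\<close>)
  then have "(2 + 64 * \<kappa>\<^sup>2) * \<rho>\<^sup>2 \<le> (1 - s) ^ 4"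
    using inner_iterations unfolding \<rho>(2) s_def mu_l_def by (simp only:)
  note rate = coupled_recursion_rate[OF \<kappa> q s \<rho>(1) this]

  define u where "u = sqrt (1 - q)"
  define r where "r = 1 - q / 2 - q\<^sup>2 / 2"
  define \<theta> where "\<theta> = sqrt r"
  define b where "b = 4 * q * (1 + \<kappa>) / u"
  have "q\<^sup>2 < 1"
    using q s by (simp add: power_less_one_iff)
  then have r: "0 < r" "r < 1"
    using q s zero_le_power2[of q] unfolding r_def by linarith+
  then have \<theta>: "0 < \<theta>"
    by (simp add: \<theta>_def)
  have b: "0 < b"
    using q s \<kappa> by (simp add: b_def u_def)

  \<comment> \<open>Error quantities and the fixed points of the local problems\<close>
  define D where "D t = norm (wg t - wg_min)" for t
  \<comment> \<open>The local error is taken at the end of round \<open>t\<close>, relative to the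
    target set by \<open>wg t\<close>, the global model with which that round worked.\<close>
  define e where "e i t = norm (w i t K - p i (wg t))" for i t
  define E where "E t = (\<Sum>i=1..m. e i t) / real m" for t
  define V where "V t = D t + b * E t" for t
  have nonneg: "0 \<le> D t" "0 \<le> e i t" "0 \<le> E t" for i t
    by (auto simp: D_def e_def E_def intro!: divide_nonneg_nonneg sum_nonneg)

  have F_gderiv: "GDERIV (F i) x :> g i x" if "i \<in> {1..m}" for i x
    using client[OF that] by (simp add: regularized_client_def smooth_strongly_convex_def)
  note stationary = fed_minimizer_stationary[OF \<open>m \<ge> 1\<close> \<open>lam > 0\<close> minimizer[folded F_def] F_gderiv]
  have w_min: "p i wg_min = w_min i" if "i \<in> {1..m}" for i
    unfolding p_def using client[OF that] stationary(1) that by (intro regularized_client.prox_eqI) auto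

  have local_start: "w i t 0 = w i (t - 1) K" if "i \<in> {1..m}" "t \<ge> 1" for i t
    using algorithm that unfolding fed_gd_def by blast
  have local_step: "w i t (k + 1) = w i t k - \<eta> *\<^sub>R (g i (w i t k) + lam *\<^sub>R (w i t k - wg t))"
    if "i \<in> {1..m}" "t \<ge> 1" "k < K" for i t k
    using algorithm that unfolding fed_gd_def g_def F_def by blast
  \<comment> \<open>The point \<open>v\<close> is \<open>wg (t + 1)\<close> when the target moves
    between rounds, and \<open>wg_min\<close> in the final estimate of the local models.\<close>
  have local_error: "norm (w i t K - p i v) \<le> e i t + \<kappa> / (1 + \<kappa>) * norm (v - wg t)"
    if i: "i \<in> {1..m}" for i t v
  proof -
    have "norm (w i t K - p i v) \<le> norm (w i t K - p i (wg t)) + norm (p i (wg t) - p i v)"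
      using norm_triangle_ineq[of "w i t K - p i (wg t)" "p i (wg t) - p i v"] by simp
    also have "norm (p i (wg t) - p i v) \<le> \<kappa> / (1 + \<kappa>) * norm (wg t - v)"
      unfolding p_def L_w[symmetric] by (rule regularized_client.prox_lipschitz[OF client[OF i]])
    finally show ?thesis
      by (simp add: e_def norm_minus_commute)
  qed

  \<comment> \<open>The global update as a perturbed gradient step\<close>
  have global: "D (t + 1) \<le> u * D t + q * (1 + \<kappa>) * E t"
    "norm (wg (t + 1) - wg t) \<le> s * D t + q * (1 + \<kappa>) * E t" if t: "t \<ge> 1" for t
  proof -
    define d where "d = wg t - wg_min"
    \<comment> \<open>At the minimizer only the average of the envelope gradients vanishes.
      Subtracting them client by client yields the monotonicity bounds and still leaves in
      \<open>A\<close> the full gradient at \<open>wg t\<close>; \<open>B\<close> is the error of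
      the inexact proximal points.\<close>
    define G where "G i = lam *\<^sub>R ((wg t - p i (wg t)) - (wg_min - p i wg_min))" for i
    define A where "A = (1 / real m) *\<^sub>R (\<Sum>i=1..m. G i)"
    define B where "B = (\<gamma> / real m) *\<^sub>R (\<Sum>i=1..m. lam *\<^sub>R (p i (wg t) - w i t K))"
    have "mu_g lam \<mu> * (norm d)\<^sup>2 \<le> G i \<bullet> d" "(norm (G i))\<^sup>2 \<le> L_g lam L * (G i \<bullet> d)"
      if "i \<in> {1..m}" for i
      using regularized_client.envelope_gradient_strongly_monotone[OF client[OF that]]
        regularized_client.envelope_gradient_cocoercive[OF client[OF that]]
      unfolding G_def p_def d_def mu_g_def L_g_def by blast+
    note A = monotone_average[where G = G, OF \<open>m \<ge> 1\<close> this, folded A_def]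
    have "(\<Sum>i=1..m. G i) = (\<Sum>i=1..m. lam *\<^sub>R (wg t - p i (wg t)))
        - (\<Sum>i=1..m. lam *\<^sub>R (wg_min - p i wg_min))"
      by (simp add: G_def scaleR_diff_right flip: sum_subtractf)
    also have "(\<Sum>i=1..m. lam *\<^sub>R (wg_min - p i wg_min)) = 0"
      using stationary(2) by (simp add: w_min)
    finally have "(\<Sum>i=1..m. G i) + (\<Sum>i=1..m. lam *\<^sub>R (p i (wg t) - w i t K))
        = (\<Sum>i=1..m. lam *\<^sub>R (wg t - w i t K))"
      by (simp add: scaleR_diff_right flip: sum.distrib)
    then have "\<gamma> *\<^sub>R A + B = (\<gamma> / real m) *\<^sub>R (\<Sum>i=1..m. lam *\<^sub>R (wg t - w i t K))"
      by (simp add: A_def B_def flip: scaleR_add_right)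
    moreover have "wg (t + 1) = wg t - (\<gamma> / real m) *\<^sub>R (\<Sum>i=1..m. lam *\<^sub>R (wg t - w i t K))"
      using algorithm t unfolding fed_gd_def by blast
    ultimately have wg: "wg (t + 1) = wg t - \<gamma> *\<^sub>R A - B"
      by (simp add: algebra_simps)
    have "norm B = \<gamma> / real m * norm (\<Sum>i=1..m. lam *\<^sub>R (p i (wg t) - w i t K))"
      using \<open>0 < \<gamma>\<close> by (simp add: B_def)
    also have "\<dots> \<le> \<gamma> / real m * (\<Sum>i=1..m. lam * e i t)"
      using \<open>0 < \<gamma>\<close> \<open>lam > 0\<close>
      by (intro mult_left_mono sum_norm_le) (auto simp: e_def norm_minus_commute)
    also have "\<dots> = \<gamma> * lam * E t"
      by (simp add: E_def flip: sum_distrib_left)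
    finally have B: "norm B \<le> q * (1 + \<kappa>) * E t"
      by (simp add: \<gamma>lam)
    have "(norm (d - \<gamma> *\<^sub>R A))\<^sup>2 \<le> (1 - q) * (norm d)\<^sup>2"
      unfolding q_def using A \<open>0 < \<gamma>\<close> s pos
      by (intro gradient_step_contraction[where M = "L_g lam L"]) (auto simp: s_def)
    then have "sqrt ((norm (d - \<gamma> *\<^sub>R A))\<^sup>2) \<le> sqrt ((1 - q) * (norm d)\<^sup>2)"
      by (rule real_sqrt_le_mono)
    then have "norm (d - \<gamma> *\<^sub>R A) \<le> u * D t"
      by (simp add: real_sqrt_mult u_def d_def D_def)
    moreover have "D (t + 1) = norm ((d - \<gamma> *\<^sub>R A) - B)"
      unfolding D_def wg d_def by (simp add: algebra_simps)
    ultimately show "D (t + 1) \<le> u * D t + q * (1 + \<kappa>) * E t"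
      using B norm_triangle_ineq4[of "d - \<gamma> *\<^sub>R A" B] by linarith
    \<comment> \<open>Cocoercivity and Cauchy-Schwarz give the Lipschitz bound, which limits the
      drift of the global model.\<close>
    have "norm A * norm A \<le> L_g lam L * (norm A * norm d)"
      using A(2) pos norm_cauchy_schwarz[of A d]
      by (smt (verit) mult_left_mono power2_eq_square)
    then have "norm A \<le> L_g lam L * norm d"
      using pos by (cases "A = 0") (auto simp: mult.left_commute)
    then have "norm (\<gamma> *\<^sub>R A) \<le> s * D t"
      using \<open>0 < \<gamma>\<close> by (simp add: s_def D_def d_def)
    moreover have "wg (t + 1) - wg t = - (\<gamma> *\<^sub>R A + B)"
      unfolding wg by simp
    then have "norm (wg (t + 1) - wg t) = norm (\<gamma> *\<^sub>R A + B)"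
      by (simp only: norm_minus_cancel)
    ultimately show "norm (wg (t + 1) - wg t) \<le> s * D t + q * (1 + \<kappa>) * E t"
      using B norm_triangle_ineq[of "\<gamma> *\<^sub>R A" B] by linarith
  qed

  \<comment> \<open>Local errors from one round to the next\<close>
  have "E (t + 1) \<le> \<rho> * (E t + \<kappa> / (1 + \<kappa>) * (s * D t + q * (1 + \<kappa>) * E t))"
    if t: "t \<ge> 1" for t
  proof -
    have "e i (t + 1) \<le> \<rho> * (e i t + \<kappa> / (1 + \<kappa>) * (s * D t + q * (1 + \<kappa>) * E t))"
      if i: "i \<in> {1..m}" for i
    proof -
      \<comment> \<open>The warm start: the initial distance to the new target is the old local
        error plus the movement of the proximal point.\<close>
      have start: "w i (t + 1) 0 = w i t K"
        using local_start[OF i, of "t + 1"] by simp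
      have "w i (t + 1) (k + 1)
          = w i (t + 1) k - \<eta> *\<^sub>R (g i (w i (t + 1) k) + lam *\<^sub>R (w i (t + 1) k - wg (t + 1)))"
        if "k < K" for k
        using local_step[OF i _ that] by simp
      then have "e i (t + 1) \<le> \<rho> * norm (w i (t + 1) 0 - p i (wg (t + 1)))"
        unfolding e_def p_def \<rho>_def
        by (intro regularized_client.local_steps_contraction[OF client[OF i] \<eta>])
      also have "\<dots> \<le> \<rho> * (e i t + \<kappa> / (1 + \<kappa>) * norm (wg (t + 1) - wg t))"
        unfolding start using \<rho> i by (intro mult_left_mono local_error) auto
      also have "\<dots> \<le> \<rho> * (e i t + \<kappa> / (1 + \<kappa>) * (s * D t + q * (1 + \<kappa>) * E t))"
        using \<rho> \<kappa> global(2)[OF t] by (intro mult_left_mono add_left_mono) auto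
      finally show ?thesis .
    qed
    then have "(\<Sum>i=1..m. e i (t + 1))
        \<le> (\<Sum>i=1..m. \<rho> * (e i t + \<kappa> / (1 + \<kappa>) * (s * D t + q * (1 + \<kappa>) * E t)))"
      by (rule sum_mono)
    also have "\<dots> = \<rho> * ((\<Sum>i=1..m. e i t) + real m * (\<kappa> / (1 + \<kappa>) * (s * D t + q * (1 + \<kappa>) * E t)))"
      by (simp add: sum.distrib flip: sum_distrib_left)
    also have "(\<Sum>i=1..m. e i t) = real m * E t"
      using \<open>m \<ge> 1\<close> by (simp add: E_def)
    also have "\<rho> * (real m * E t + real m * (\<kappa> / (1 + \<kappa>) * (s * D t + q * (1 + \<kappa>) * E t)))
        = real m * (\<rho> * (E t + \<kappa> / (1 + \<kappa>) * (s * D t + q * (1 + \<kappa>) * E t)))"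
      by (simp only: distrib_left mult.left_commute)
    finally show ?thesis
      unfolding E_def[of "t + 1"] using \<open>m \<ge> 1\<close> by (simp add: pos_divide_le_eq mult.commute)
  qed
  \<comment> \<open>The factor \<open>1 + \<kappa>\<close> cancels, which gives the coefficients in
    \<open>coupled_recursion_rate\<close>.\<close>
  moreover have "E t + \<kappa> / (1 + \<kappa>) * (s * D t + q * (1 + \<kappa>) * E t)
      = \<kappa> / (1 + \<kappa>) * s * D t + (1 + q * \<kappa>) * E t" for t
    using \<kappa> by (simp add: field_simps)
  ultimately have local: "b * E (t + 1)
      \<le> b * (\<rho> * (\<kappa> / (1 + \<kappa>) * s * D t + (1 + q * \<kappa>) * E t))" if "t \<ge> 1" for t
    using that b by simp

  \<comment> \<open>Decay of the weighted error, and convergence of both sequences\<close>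
  have V_step: "V (t + 1) \<le> \<theta> * V t" if t: "t \<ge> 1" for t
  proof -
    have "V (t + 1) \<le> (u + b * (\<rho> * (\<kappa> / (1 + \<kappa>) * s))) * D t
        + (q * (1 + \<kappa>) + b * (\<rho> * (1 + q * \<kappa>))) * E t"
      using global(1)[OF t] local[OF t] by (simp add: V_def algebra_simps)
    also have "\<dots> \<le> \<theta> * D t + (b * \<theta>) * E t"
      using rate nonneg unfolding u_def b_def \<theta>_def r_def
      by (intro add_mono mult_right_mono) auto
    finally show ?thesis
      by (simp add: V_def algebra_simps)
  qed
  \<comment> \<open>The division by \<open>\<theta>\<close> accounts for the recursion starting at
    round 1.\<close>
  define C where "C = V 1 / \<theta>"
  have V: "V t \<le> C * \<theta> ^ t" if "t \<ge> 1" for t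
    using that
  proof (induction t rule: dec_induct)
    case base
    show ?case
      using \<theta> by (simp add: C_def)
  next
    case (step t)
    have "V (t + 1) \<le> \<theta> * V t"
      using step by (intro V_step) auto
    also have "\<dots> \<le> \<theta> * (C * \<theta> ^ t)"
      using step \<theta> by (intro mult_left_mono) auto
    finally show ?case
      by (simp add: algebra_simps)
  qed

  \<comment> \<open>Convergence is measured in squared norms, so a bound on norms by powers of
    \<open>\<theta> = sqrt r\<close> yields the rate \<open>r\<close>.\<close>
  have linear: "converges_linearly x y r"
    if "\<And>t. t \<ge> 1 \<Longrightarrow> norm (x t - y) \<le> c * \<theta> ^ t" for x :: "nat \<Rightarrow> real ^ 'd" and y c
    unfolding converges_linearly_def
  proof (intro conjI exI allI impI)
    fix t :: nat assume "t \<ge> 1"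
    then have "(norm (x t - y))\<^sup>2 \<le> (c * \<theta> ^ t)\<^sup>2"
      using that by (intro power_mono) auto
    also have "\<dots> = c\<^sup>2 * (\<theta>\<^sup>2) ^ t"
      by (simp add: power_mult_distrib mult.commute flip: power_mult)
    finally show "(norm (x t - y))\<^sup>2 \<le> c\<^sup>2 * r ^ t"
      using r by (simp add: \<theta>_def)
  qed (use r in auto)

  have "D t \<le> V t" for t
    using b nonneg by (simp add: V_def)
  then have "converges_linearly wg wg_min r"
    using V by (intro linear[of _ _ C]) (auto simp: D_def intro: order_trans)
  moreover have "converges_linearly (\<lambda>t. w i t 0) (w_min i) r" if i: "i \<in> {1..m}" for i
  proof (rule linear)
    fix t :: nat assume t: "t \<ge> 1"
    \<comment> \<open>For \<open>t \<ge> 2\<close> the local model comes from round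
      \<open>t - 1\<close>, and the lost power of \<open>\<theta>\<close> is put into
      \<open>c\<close>. In round 1 it is the arbitrary initial model, on which \<open>V\<close> has
      no hold; \<open>c\<^sub>1\<close> covers it. Neither constant depends on
      \<open>t\<close>.\<close>
    define c where "c = (real m / b + 1) * C / \<theta>"
    define c\<^sub>1 where "c\<^sub>1 = norm (w i 1 0 - w_min i) / \<theta>"
    show "norm (w i t 0 - w_min i) \<le> max c c\<^sub>1 * \<theta> ^ t"
    proof (cases "t = 1")
      case True
      have "c\<^sub>1 * \<theta> \<le> max c c\<^sub>1 * \<theta>"
        using \<theta> by (intro mult_right_mono) auto
      then show ?thesis
        using True \<theta> by (simp add: c\<^sub>1_def)
    next
      case False
      define t' where "t' = t - 1"
      have t': "t = t' + 1" "t' \<ge> 1"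
        using t False by (auto simp: t'_def)
      have "w i t 0 = w i t' K"
        using local_start[OF i t] by (simp add: t'_def)
      then have "norm (w i t 0 - w_min i) \<le> e i t' + \<kappa> / (1 + \<kappa>) * D t'"
        using local_error[OF i, of t' wg_min] w_min[OF i] by (simp add: D_def norm_minus_commute)
      also have "\<dots> \<le> (real m / b) * V t' + 1 * V t'"
      proof (intro add_mono mult_mono)
        \<comment> \<open>The error of one client is at most the sum over all clients, at the price
          of the factor \<open>m\<close>.\<close>
        have "e i t' \<le> (\<Sum>j=1..m. e j t')"
          using i nonneg by (intro member_le_sum) auto
        also have "\<dots> = (real m / b) * (b * E t')"
          using b \<open>m \<ge> 1\<close> by (simp add: E_def)
        also have "\<dots> \<le> (real m / b) * V t'"
          using b nonneg by (intro mult_left_mono) (auto simp: V_def)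
        finally show "e i t' \<le> (real m / b) * V t'" .
      qed (use \<kappa> nonneg \<open>\<And>t. D t \<le> V t\<close> in auto)
      also have "\<dots> = (real m / b + 1) * V t'"
        by (simp add: algebra_simps)
      also have "\<dots> \<le> (real m / b + 1) * (C * \<theta> ^ t')"
        using b V t' by (intro mult_left_mono) auto
      also have "\<dots> = c * \<theta> ^ t"
        using \<theta> t' by (simp add: c_def)
      also have "\<dots> \<le> max c c\<^sub>1 * \<theta> ^ t"
        using \<theta> by (intro mult_right_mono) auto
      finally show ?thesis .
    qed
  qed
  ultimately show ?thesis
    by (simp add: r_def q_def)
qed

end
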